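(* Let $\mathbf H$ be a finite connected ordered hypergraph. The generalised flip order $\leq$, i.e. the reflexive and transitive closure of the covering relation $\lessdot$ on the set of all constructs of $\mathbf H$, is a partial order.
   Context: A (finite) hypergraph $\mathbf H$ with finite vertex set $H$ is a set of non-empty subsets of $H$ (hyperedges) with $\bigcup\mathbf H=H$ and $\{x\}\in\mathbf H$ for all $x\in H$. For $X\subseteq H$, $\mathbf H_X:=\{Z\in\mathbf H: Z\subseteq X\}$ and $\mathbf H\setminus X:=\mathbf H_{H\setminus X}$. $\mathbf H$ is connected if there is no partition $H=X_1\cup X_2$ into two non-empty parts with $\mathbf H=\mathbf H_{X_1}\cup\mathbf H_{X_2}$. Every hypergraph is uniquely the union of its connected components; $\mathbf H,X\leadsto H_1,\dots,H_n$ means that $\mathbf H_{H_1},\dots,\mathbf H_{H_n}$ are the connected components of $\mathbf H\setminus X$. Constructs of a connected hypergraph $\mathbf H$ are non-planar rooted trees with nodes labelled by non-empty subsets of $H$, defined recursively: the one-node tree labelled $H$ is a construct of $\mathbf H$; if $\emptyset\neq Y\subsetneq H$, $\mathbf H,Y\leadsto H_1,\dots,H_n$, and $T_i$ is a construct of $\mathbf H_{H_i}$ for each $i$, then the tree $Y(T_1,\dots,T_n)$ with root $Y$ and immediate subtrees $T_1,\dots,T_n$ is a construct of $\mathbf H$. Nodes are identified with their labels (the labels partition $H$). $\mathbf H$ is ordered if $H$ carries a total order; for non-empty $Y,Z\subseteq H$, $Y<Z$ (or $Z>Y$) means $\max Y<\min Z$. If in a construct $S$ the node $X$ is the parent of the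 node $Y$, contracting the edge between them and labelling the merged node $X\cup Y$ yields a construct $T$; write $S\subset_{X,Y}T$. For constructs $S,S'$ of $\mathbf H$, $S\lessdot S'$ iff there exist $U,V$ with $U>V$ such that either $S\subset_{U,V}S'$ (fusion) or $S'\subset_{V,U}S$ (split). *)

theory Defs
  imports "HOL-Library.Multiset" "HOL-Library.Disjoint_Sets"
begin

text \<open>
  A hypergraph is represented by its set of hyperedges \<open>E\<close> alone, since its vertex set is
  \<open>\<Union>E\<close>. Because of the singleton hyperedges, the vertex set of \<open>restrict_hyp E X\<close> is \<open>X\<close>
  whenever \<open>X \<subseteq> \<Union>E\<close>. An ordered hypergraph is one whose vertices live in a type of class
  \<open>linorder\<close>.
\<close>

definition hypergraph :: "'a set set \<Rightarrow> bool" where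
  "hypergraph E \<longleftrightarrow> finite (\<Union>E) \<and> {} \<notin> E \<and> (\<forall>x\<in>\<Union>E. {x} \<in> E)"

definition restrict_hyp :: "'a set set \<Rightarrow> 'a set \<Rightarrow> 'a set set" where
  "restrict_hyp E X = {Z \<in> E. Z \<subseteq> X}"

definition remove_hyp :: "'a set set \<Rightarrow> 'a set \<Rightarrow> 'a set set" where
  "remove_hyp E X = restrict_hyp E (\<Union>E - X)"

definition connected_hyp :: "'a set set \<Rightarrow> bool" where
  "connected_hyp E \<longleftrightarrow>
     \<not> (\<exists>X1 X2. X1 \<noteq> {} \<and> X2 \<noteq> {} \<and> X1 \<inter> X2 = {} \<and> X1 \<union> X2 = \<Union>E \<and>
         E = restrict_hyp E X1 \<union> restrict_hyp E X2)"

text \<open>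
  \<open>components_hyp E P\<close>: the blocks of \<open>P\<close> are the vertex sets of the connected components of \<open>E\<close>.
  For a hypergraph \<open>E\<close> there is exactly one such \<open>P\<close>. The relation \<open>E, X \<leadsto> H\<^sub>1, \<dots>, H\<^sub>n\<close> is
  \<open>components_hyp (remove_hyp E X) {H\<^sub>1, \<dots>, H\<^sub>n}\<close>.
\<close>

definition components_hyp :: "'a set set \<Rightarrow> 'a set set \<Rightarrow> bool" where
  "components_hyp E P \<longleftrightarrow>
     partition_on (\<Union>E) P \<and> E = (\<Union>C\<in>P. restrict_hyp E C) \<and>
     (\<forall>C\<in>P. connected_hyp (restrict_hyp E C))"

text \<open>Non-planar rooted trees: the immediate subtrees form a multiset.\<close>

datatype 'a ltree = Node (label: "'a set") (subtrees: "'a ltree multiset")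

text \<open>
  In the second rule, \<open>T C\<close> is the chosen construct of the component with vertex set \<open>C\<close>;
  \<open>P\<close> is finite whenever \<open>\<Union>E\<close> is.
\<close>

inductive construct :: "'a set set \<Rightarrow> 'a ltree \<Rightarrow> bool" where
  single: "\<Union>E \<noteq> {} \<Longrightarrow> construct E (Node (\<Union>E) {#})"
| graft: "Y \<noteq> {} \<Longrightarrow> Y \<subset> \<Union>E \<Longrightarrow> components_hyp (remove_hyp E Y) P \<Longrightarrow>
    (\<And>C. C \<in> P \<Longrightarrow> construct (restrict_hyp E C) (T C)) \<Longrightarrow>
    construct E (Node Y (image_mset T (mset_set P)))"

definition constructs :: "'a set set \<Rightarrow> 'a ltree set" where
  "constructs E = {S. construct E S}"

text \<open>
  \<open>contracts X Y S T\<close>: in \<open>S\<close> a node labelled \<open>X\<close> is the parent of a node labelled \<open>Y\<close>, and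
  \<open>T\<close> arises from \<open>S\<close> by contracting the edge between them, the merged node being labelled
  \<open>X \<union> Y\<close>.
\<close>

inductive contracts :: "'a set \<Rightarrow> 'a set \<Rightarrow> 'a ltree \<Rightarrow> 'a ltree \<Rightarrow> bool"
  for X Y :: "'a set" where
  at_root: "contracts X Y (Node X (add_mset (Node Y Ds) Cs)) (Node (X \<union> Y) (Cs + Ds))"
| below: "contracts X Y S T \<Longrightarrow>
    contracts X Y (Node Z (add_mset S Cs)) (Node Z (add_mset T Cs))"

text \<open>Only meaningful for non-empty finite sets, as the labels of a construct are.\<close>

definition set_less :: "'a::linorder set \<Rightarrow> 'a set \<Rightarrow> bool" where
  "set_less Y Z \<longleftrightarrow> Max Y < Min Z"

definition flip_cover :: "'a::linorder set set \<Rightarrow> ('a ltree \<times> 'a ltree) set" where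
  "flip_cover E = {(S, S'). S \<in> constructs E \<and> S' \<in> constructs E \<and>
     (\<exists>U V. set_less V U \<and> (contracts U V S S' \<or> contracts V U S' S))}"

text \<open>
  HOL's reflexive-transitive closure is reflexive on the whole type of trees, so it is restricted to
  the constructs of \<open>E\<close>.
\<close>

definition flip_order :: "'a::linorder set set \<Rightarrow> ('a ltree \<times> 'a ltree) set" where
  "flip_order E = (flip_cover E)\<^sup>* \<inter> constructs E \<times> constructs E"

end

theory Submission
  imports Defs
begin

text \<open>
  A connected set \<open>Z\<close> of vertices stays inside one subtree of a construct \<open>S\<close> until a node \<open>W\<close>
  meets it; consider \<open>W \<inter> Z\<close> for this topmost node. Geometrically, \<open>Max (W \<inter> Z)\<close> and
  \<open>Min (W \<inter> Z)\<close> describe the two extremal vertices, for a generic linear functional, of the face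
  of the nestohedron labelled by \<open>S\<close>. A covering step \<open>S \<lessdot> S'\<close> increases neither value for any
  \<open>Z\<close>: a fusion of \<open>U\<close> over \<open>V\<close> with \<open>U > V\<close> replaces some \<open>U \<inter> Z\<close> by \<open>(U \<union> V) \<inter> Z\<close>, a split
  replaces some \<open>(V \<union> U) \<inter> Z\<close> by \<open>V \<inter> Z\<close>. When \<open>Z\<close> is the vertex set of the subtree in which
  the step takes place, one of the two values strictly decreases. Hence there are no cycles.
\<close>

section \<open>Restrictions and connected vertex sets\<close>

lemma Union_restrict_hyp:
  assumes "hypergraph E" "X \<subseteq> \<Union>E"
  shows "\<Union>(restrict_hyp E X) = X"
proof
  show "\<Union>(restrict_hyp E X) \<subseteq> X"
    by (auto simp: restrict_hyp_def)
  show "X \<subseteq> \<Union>(restrict_hyp E X)"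
  proof
    fix x assume "x \<in> X"
    then have "{x} \<in> restrict_hyp E X"
      using assms by (auto simp: restrict_hyp_def hypergraph_def)
    then show "x \<in> \<Union>(restrict_hyp E X)" by blast
  qed
qed

lemma hypergraph_restrict_hyp: "hypergraph E \<Longrightarrow> hypergraph (restrict_hyp E X)"
  unfolding hypergraph_def restrict_hyp_def by (auto elim: rev_finite_subset)

lemma restrict_hyp_restrict_hyp: "Z \<subseteq> X \<Longrightarrow> restrict_hyp (restrict_hyp E X) Z = restrict_hyp E Z"
  by (auto simp: restrict_hyp_def)

lemma restrict_hyp_Union: "restrict_hyp E (\<Union>E) = E"
  by (auto simp: restrict_hyp_def)

definition connected_sets :: "'a set set \<Rightarrow> 'a set set" where
  "connected_sets E = {Z. Z \<subseteq> \<Union>E \<and> connected_hyp (restrict_hyp E Z)}"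

lemma connected_sets_restrict_hyp:
  assumes "hypergraph E" "X \<subseteq> \<Union>E"
  shows "connected_sets (restrict_hyp E X) = {Z \<in> connected_sets E. Z \<subseteq> X}"
  using assms by (auto simp: connected_sets_def Union_restrict_hyp restrict_hyp_restrict_hyp)

text \<open>A hyperedge inside \<open>Z\<close> avoids \<open>Y\<close>, hence lies in a single
  component and so either inside \<open>C\<close> or off \<open>C\<close>. If \<open>Z\<close> left
  \<open>C\<close>, the parts \<open>Z \<inter> C\<close> and \<open>Z - C\<close> would disconnect
  it.\<close>

lemma connected_set_within_component:
  assumes E: "hypergraph E" and P: "components_hyp (remove_hyp E Y) P" "C \<in> P"
    and Z: "Z \<in> connected_sets E" "Z \<inter> Y = {}" "Z \<inter> C \<noteq> {}"
  shows "Z \<subseteq> C"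
proof (rule ccontr)
  assume not_sub: "\<not> Z \<subseteq> C"
  have edge: "W \<subseteq> Z \<inter> C \<or> W \<subseteq> Z - C" if W: "W \<in> E" "W \<subseteq> Z" for W
  proof -
    have "W \<in> remove_hyp E Y"
      using W Z by (auto simp: remove_hyp_def restrict_hyp_def)
    then have "W \<in> (\<Union>C\<in>P. restrict_hyp (remove_hyp E Y) C)"
      using P by (simp add: components_hyp_def)
    then obtain C' where C': "C' \<in> P" "W \<subseteq> C'"
      by (auto simp: restrict_hyp_def)
    have "C' = C \<or> C' \<inter> C = {}"
      using P C' unfolding components_hyp_def partition_on_def disjoint_def by blast
    then show ?thesis using W C' by blast
  qed
  have "restrict_hyp E Z =
      restrict_hyp (restrict_hyp E Z) (Z \<inter> C) \<union> restrict_hyp (restrict_hyp E Z) (Z - C)"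
    using edge by (auto simp: restrict_hyp_def)
  moreover have "(Z \<inter> C) \<union> (Z - C) = \<Union>(restrict_hyp E Z)"
    using Union_restrict_hyp[OF E] Z by (auto simp: connected_sets_def)
  moreover have "Z - C \<noteq> {}" "(Z \<inter> C) \<inter> (Z - C) = {}"
    using not_sub by auto
  ultimately have "\<not> connected_hyp (restrict_hyp E Z)"
    unfolding connected_hyp_def not_not using Z(3)
    by (intro exI[of _ "Z \<inter> C"] exI[of _ "Z - C"] conjI)
  then show False using Z by (simp add: connected_sets_def)
qed

section \<open>Topmost nodes meeting a vertex set\<close>

text \<open>
  All topmost nodes meeting \<open>Z\<close> are taken together, which makes \<open>tops\<close> total; there is only one
  such node when \<open>Z\<close> is connected.
\<close>

primrec tops :: "'a set \<Rightarrow> 'a ltree \<Rightarrow> 'a set" where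
  "tops Z (Node Y Cs) =
     (if Y \<inter> Z \<noteq> {} then Y \<inter> Z else \<Union>(set_mset (image_mset (tops Z) Cs)))"

lemma tops_subset: "tops Z S \<subseteq> Z"
  by (induction S) auto

lemma construct_tops_subset: "construct E S \<Longrightarrow> tops Z S \<subseteq> \<Union>E"
proof (induction rule: construct.induct)
  case (single E)
  then show ?case by auto
next
  case (graft Y E P T)
  have "tops Z (T C) \<subseteq> \<Union>E" if "C \<in># mset_set P" for C
  proof -
    \<comment> \<open>\<open>mset_set\<close> of an infinite set is empty by convention, hence the
      case distinction.\<close>
    have "C \<in> P"
      using that by (cases "finite P") auto
    then have "tops Z (T C) \<subseteq> \<Union>(restrict_hyp E C)" using graft.IH by blast
    then show ?thesis by (auto simp: restrict_hyp_def)
  qed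
  then show ?case using graft.hyps by auto
qed

section \<open>Children of a construct and the effect of a contraction\<close>

lemma construct_label:
  assumes "construct E (Node Y Cs)"
  shows "Y \<noteq> {}" "Y \<subseteq> \<Union>E"
  using assms by (auto elim: construct.cases)

text \<open>\<open>tops Z\<close> is empty exactly when \<open>Z\<close> misses all labels, and a
  contraction preserves the union of the labels.\<close>

lemma contracts_tops_empty_iff: "contracts U V S T \<Longrightarrow> tops Z S = {} \<longleftrightarrow> tops Z T = {}"
  by (induction rule: contracts.induct) auto

lemma image_mset_set_eq_add_mset:
  assumes "image_mset f (mset_set A) = add_mset y M"
  obtains x where "x \<in> A" "f x = y" "M = image_mset f (mset_set (A - {x}))"
proof -
  from assms have "mset_set A \<noteq> {#}" by auto
  then have fin: "finite A" by (meson mset_set.infinite)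
  from assms have "y \<in># image_mset f (mset_set A)" by simp
  then obtain x where x: "x \<in> A" "f x = y" using fin by auto
  have "mset_set A = add_mset x (mset_set (A - {x}))"
    using fin x by (simp add: mset_set.remove)
  then have "M = image_mset f (mset_set (A - {x}))"
    using assms x by simp
  with x show ?thesis by (rule that)
qed

text \<open>Isolates one child and its component \<open>C\<close> for inductions over
  \<open>contracts\<close>. A connected \<open>Z\<close> avoiding the root and meeting
  \<open>C\<close> is trapped in \<open>C\<close>, so the siblings, living on disjoint components,
  contribute nothing to \<open>tops Z\<close>.\<close>

lemma construct_child:
  assumes E: "hypergraph E" and S: "construct E (Node Y (add_mset S Cs))"
  obtains C where "C \<subseteq> \<Union>E - Y" "connected_hyp (restrict_hyp E C)"
    "construct (restrict_hyp E C) S"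
    "\<forall>Z\<in>connected_sets E. Z \<inter> Y = {} \<longrightarrow> Z \<inter> C \<noteq> {} \<longrightarrow>
       Z \<subseteq> C \<and> (\<forall>R\<in>#Cs. tops Z R = {})"
  using S
proof cases
  case single
  then show ?thesis by simp
next
  case (graft P T)
  then obtain C where C: "C \<in> P" "T C = S" and Cs: "Cs = image_mset T (mset_set (P - {C}))"
    by (metis image_mset_set_eq_add_mset)
  have C_sub: "C \<subseteq> \<Union>E - Y"
    using graft(4) C by (auto simp: components_hyp_def partition_on_def remove_hyp_def restrict_hyp_def)
  have "connected_hyp (restrict_hyp (remove_hyp E Y) C)"
    using graft(4) C by (simp add: components_hyp_def)
  then have conn: "connected_hyp (restrict_hyp E C)"
    using C_sub by (simp add: remove_hyp_def restrict_hyp_restrict_hyp)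
  have constr: "construct (restrict_hyp E C) S"
    using graft C by blast
  have "Z \<subseteq> C \<and> (\<forall>R\<in>#Cs. tops Z R = {})"
    if Z: "Z \<in> connected_sets E" "Z \<inter> Y = {}" "Z \<inter> C \<noteq> {}" for Z
  proof -
    have ZC: "Z \<subseteq> C"
      using connected_set_within_component[OF E graft(4) C(1) Z] .
    have "tops Z R = {}" if "R \<in># Cs" for R
    proof -
      from that obtain D where D: "D \<in> P" "D \<noteq> C" "R = T D"
        unfolding Cs by (cases "finite (P - {C})") auto
      then have "tops Z R \<subseteq> \<Union>(restrict_hyp E D)"
        using graft(5) construct_tops_subset by blast
      then have "tops Z R \<subseteq> D" by (auto simp: restrict_hyp_def)
      moreover have "D \<inter> C = {}"
        using graft(4) C D unfolding components_hyp_def partition_on_def disjoint_def by blast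
      ultimately show ?thesis using tops_subset[of Z R] ZC by blast
    qed
    with ZC show ?thesis by blast
  qed
  then show ?thesis by (intro that[OF C_sub conn constr]) simp
qed

text \<open>Connectedness is decisive when \<open>Z\<close> meets \<open>V\<close> but not
  \<open>U\<close>: then the siblings of \<open>V\<close> contribute nothing, so
  \<open>tops Z\<close> is \<open>V \<inter> Z\<close> before the contraction and remains so. Only
  sets meeting \<open>U\<close> can notice the merge.\<close>

lemma contracts_tops:
  assumes "contracts U V S T" "hypergraph E" "construct E S" "Z \<in> connected_sets E"
  shows "tops Z T = tops Z S \<or> U \<inter> Z \<noteq> {} \<and> tops Z S = U \<inter> Z \<and> tops Z T = (U \<union> V) \<inter> Z"
  using assms
proof (induction arbitrary: E rule: contracts.induct)
  case (at_root Ds Cs)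
  obtain C where C: "construct (restrict_hyp E C) (Node V Ds)"
    "Z \<inter> U = {} \<Longrightarrow> Z \<inter> C \<noteq> {} \<Longrightarrow> Z \<subseteq> C \<and> (\<forall>R\<in>#Cs. tops Z R = {})"
    using construct_child[OF at_root(1,2)] at_root(3) by metis
  have "V \<subseteq> \<Union>(restrict_hyp E C)"
    by (rule construct_label[OF C(1)])
  then have "V \<subseteq> C" by (auto simp: restrict_hyp_def)
  then show ?case using C(2) by auto
next
  case (below S T Y Cs)
  obtain C where C: "C \<subseteq> \<Union>E - Y" "construct (restrict_hyp E C) S"
    "Z \<inter> Y = {} \<Longrightarrow> Z \<inter> C \<noteq> {} \<Longrightarrow> Z \<subseteq> C \<and> (\<forall>R\<in>#Cs. tops Z R = {})"
    using construct_child[OF below.prems(1,2)] below.prems(3) by metis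
  consider "Z \<inter> Y \<noteq> {}" | "Z \<inter> Y = {}" "Z \<inter> C \<noteq> {}" | "Z \<inter> Y = {}" "Z \<inter> C = {}"
    by blast
  then show ?case
  proof cases
    case 1
    then show ?thesis by auto
  next
    case 2
    then have Z: "Z \<subseteq> C" "\<forall>R\<in>#Cs. tops Z R = {}" using C(3) by auto
    have "Z \<in> connected_sets (restrict_hyp E C)"
      using Z below.prems C(1) by (subst connected_sets_restrict_hyp) auto
    from below.IH[OF hypergraph_restrict_hyp[OF below.prems(1)] C(2) this]
    show ?thesis using 2 Z by (auto simp: Int_commute)
  next
    case 3
    \<comment> \<open>\<open>Z\<close> misses the whole component, so the changed subtree
      contributes nothing before or after.\<close>
    have "tops Z S \<subseteq> \<Union>(restrict_hyp E C)" using construct_tops_subset[OF C(2)] .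
    also have "\<dots> \<subseteq> C" by (auto simp: restrict_hyp_def)
    finally have "tops Z S = {}"
      using 3 tops_subset[of Z S] by blast
    with contracts_tops_empty_iff[OF below.hyps, of Z] show ?thesis by auto
  qed
qed

lemma contracts_tops_witness:
  assumes "contracts U V S T" "hypergraph E" "connected_hyp E" "construct E S"
  shows "U \<noteq> {} \<and> V \<noteq> {} \<and> U \<union> V \<subseteq> \<Union>E \<and>
    (\<exists>Z\<in>connected_sets E. tops Z S = U \<and> tops Z T = U \<union> V)"
  using assms
proof (induction arbitrary: E rule: contracts.induct)
  case (at_root Ds Cs)
  obtain C where C: "C \<subseteq> \<Union>E - U" "construct (restrict_hyp E C) (Node V Ds)"
    using construct_child[OF at_root(1,3)] by metis
  note U = construct_label[OF at_root(3)]
  note V = construct_label[OF C(2)]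
  have V_sub: "V \<subseteq> \<Union>E" using V(2) by (auto simp: restrict_hyp_def)
  \<comment> \<open>The merged edge is at the root, so the witness is the full vertex set; deeper
    down the witness is inherited from the component.\<close>
  have "\<Union>E \<in> connected_sets E"
    using at_root by (simp add: connected_sets_def restrict_hyp_Union)
  moreover have "U \<inter> \<Union>E = U" "(U \<union> V) \<inter> \<Union>E = U \<union> V" using U V_sub by auto
  then have "tops (\<Union>E) (Node U (add_mset (Node V Ds) Cs)) = U"
    "tops (\<Union>E) (Node (U \<union> V) (Cs + Ds)) = U \<union> V"
    using U(1) by (simp_all only: tops.simps) auto
  ultimately show ?case using U V V_sub by blast
next
  case (below S T Y Cs)
  obtain C where C: "C \<subseteq> \<Union>E - Y" "connected_hyp (restrict_hyp E C)"
    "construct (restrict_hyp E C) S"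
    "\<forall>Z\<in>connected_sets E. Z \<inter> Y = {} \<longrightarrow> Z \<inter> C \<noteq> {} \<longrightarrow>
       Z \<subseteq> C \<and> (\<forall>R\<in>#Cs. tops Z R = {})"
    by (rule construct_child[OF below.prems(1,3)])
  from below.IH[OF hypergraph_restrict_hyp[OF below.prems(1)] C(2,3)]
  obtain Z where UV: "U \<noteq> {}" "V \<noteq> {}" "U \<union> V \<subseteq> \<Union>(restrict_hyp E C)"
    and Z: "Z \<in> connected_sets (restrict_hyp E C)" "tops Z S = U" "tops Z T = U \<union> V"
    by blast
  have sub: "C \<subseteq> \<Union>E" using C(1) by blast
  have ZE: "Z \<in> connected_sets E" "Z \<subseteq> C"
    using Z(1) connected_sets_restrict_hyp[OF below.prems(1) sub] by auto
  have ZY: "Z \<inter> Y = {}" using ZE C(1) by blast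
  have "Z \<inter> C \<noteq> {}" using UV(1) Z(2) tops_subset[of Z S] ZE(2) by blast
  then have "\<forall>R\<in>#Cs. tops Z R = {}" using C(4) ZE(1) ZY by blast
  then have "tops Z (Node Y (add_mset S Cs)) = U" "tops Z (Node Y (add_mset T Cs)) = U \<union> V"
    using ZY Z by (auto simp: Int_commute)
  moreover have "U \<union> V \<subseteq> \<Union>E" using UV(3) by (auto simp: restrict_hyp_def)
  ultimately show ?case using UV ZE(1) by blast
qed

section \<open>Strict monotonicity along covering steps\<close>

text \<open>The empty set counts as connected here; for it both sides are the same unspecified
  \<open>Max {}\<close> or \<open>Min {}\<close>, so the comparison holds trivially.\<close>

definition tops_le :: "'a::linorder set set \<Rightarrow> 'a ltree \<Rightarrow> 'a ltree \<Rightarrow> bool" where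
  "tops_le E S T \<longleftrightarrow> (\<forall>Z\<in>connected_sets E.
     Max (tops Z S) \<le> Max (tops Z T) \<and> Min (tops Z S) \<le> Min (tops Z T))"

lemma tops_le_trans: "tops_le E S T \<Longrightarrow> tops_le E T R \<Longrightarrow> tops_le E S R"
  unfolding tops_le_def by (auto intro: order_trans)

lemma set_lessD:
  assumes "set_less Y Z" "finite Y" "finite Z" "y \<in> Y" "z \<in> Z"
  shows "y < z"
proof -
  have "y \<le> Max Y" using assms by simp
  also have "Max Y < Min Z" using assms by (simp add: set_less_def)
  also have "Min Z \<le> z" using assms by simp
  finally show ?thesis .
qed

text \<open>Adding elements of \<open>V\<close> to a non-empty \<open>U \<inter> X\<close> keeps its
  maximum and can only lower its minimum, as \<open>V\<close> lies below \<open>U\<close>. At the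
  witness the minimum drops strictly.\<close>

lemma fusion_tops:
  assumes "contracts U V S T" "set_less V U" "hypergraph E" "connected_hyp E" "construct E S"
  shows "tops_le E T S \<and> \<not> tops_le E S T"
proof -
  from contracts_tops_witness[OF assms(1,3,4,5)] obtain Z where
    UV: "U \<noteq> {}" "V \<noteq> {}" "U \<union> V \<subseteq> \<Union>E"
    and Z: "Z \<in> connected_sets E" "tops Z S = U" "tops Z T = U \<union> V" by blast
  have fin: "finite U" "finite V"
    using UV(3) assms(3) by (auto simp: hypergraph_def dest: finite_subset)
  have less: "v < u" if "u \<in> U" "v \<in> V" for u v
    using set_lessD assms(2) fin that by blast
  have "Max ((U \<union> V) \<inter> X) \<le> Max (U \<inter> X) \<and> Min ((U \<union> V) \<inter> X) \<le> Min (U \<inter> X)"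
    if X: "U \<inter> X \<noteq> {}" for X
  proof
    obtain u where u: "u \<in> U" "u \<in> X" using X by blast
    have "x \<le> Max (U \<inter> X)" if "x \<in> (U \<union> V) \<inter> X" for x
    proof (cases "x \<in> U")
      case True
      then show ?thesis using that fin by simp
    next
      case False
      then have "x < u" using that u less by blast
      also have "u \<le> Max (U \<inter> X)" using u fin by simp
      finally show ?thesis by simp
    qed
    then show "Max ((U \<union> V) \<inter> X) \<le> Max (U \<inter> X)"
      using fin u by (subst Max_le_iff) auto
    show "Min ((U \<union> V) \<inter> X) \<le> Min (U \<inter> X)"
      using fin X by (intro Min_antimono) auto
  qed
  then have "tops_le E T S"
    unfolding tops_le_def using contracts_tops[OF assms(1,3,5)] by fastforce
  moreover have "Min (U \<union> V) < Min U"
  proof -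
    obtain v where "v \<in> V" using UV by blast
    then have "Min (U \<union> V) \<le> v" using fin by simp
    also have "v < Min U" using less fin UV \<open>v \<in> V\<close> by simp
    finally show ?thesis .
  qed
  then have "\<not> tops_le E S T"
    unfolding tops_le_def using Z by (metis not_le)
  ultimately show ?thesis by blast
qed

text \<open>Dual to fusion: \<open>T\<close> is now the finer tree. Adding elements of
  \<open>U\<close> to a non-empty \<open>V \<inter> X\<close> keeps the minimum and can only raise
  the maximum, strictly so at the witness.\<close>

lemma split_tops:
  assumes "contracts V U T S" "set_less V U" "hypergraph E" "connected_hyp E" "construct E T"
  shows "tops_le E T S \<and> \<not> tops_le E S T"
proof -
  from contracts_tops_witness[OF assms(1,3,4,5)] obtain Z where
    UV: "V \<noteq> {}" "U \<noteq> {}" "V \<union> U \<subseteq> \<Union>E"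
    and Z: "Z \<in> connected_sets E" "tops Z T = V" "tops Z S = V \<union> U" by blast
  have fin: "finite U" "finite V"
    using UV(3) assms(3) by (auto simp: hypergraph_def dest: finite_subset)
  have less: "v < u" if "u \<in> U" "v \<in> V" for u v
    using set_lessD assms(2) fin that by blast
  have "Max (V \<inter> X) \<le> Max ((V \<union> U) \<inter> X) \<and> Min (V \<inter> X) \<le> Min ((V \<union> U) \<inter> X)"
    if X: "V \<inter> X \<noteq> {}" for X
  proof
    obtain v where v: "v \<in> V" "v \<in> X" using X by blast
    have "Min (V \<inter> X) \<le> x" if "x \<in> (V \<union> U) \<inter> X" for x
    proof (cases "x \<in> V")
      case True
      then show ?thesis using that fin by simp
    next
      case False
      have "Min (V \<inter> X) \<le> v" using v fin by simp
      also have "v < x" using False that v less by blast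
      finally show ?thesis by simp
    qed
    then show "Min (V \<inter> X) \<le> Min ((V \<union> U) \<inter> X)"
      using fin v by (subst Min_ge_iff) auto
    show "Max (V \<inter> X) \<le> Max ((V \<union> U) \<inter> X)"
      using fin X by (intro Max_mono) auto
  qed
  then have "tops_le E T S"
    unfolding tops_le_def using contracts_tops[OF assms(1,3,5)] by fastforce
  moreover have "Max V < Max (V \<union> U)"
  proof -
    obtain u where "u \<in> U" using UV by blast
    then have "Max V < u" using less fin UV by simp
    also have "u \<le> Max (V \<union> U)" using fin \<open>u \<in> U\<close> by simp
    finally show ?thesis .
  qed
  then have "\<not> tops_le E S T"
    unfolding tops_le_def using Z by (metis not_le)
  ultimately show ?thesis by blast
qed

lemma flip_cover_tops:
  assumes "hypergraph E" "connected_hyp E" "(S, T) \<in> flip_cover E"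
  shows "tops_le E T S" "\<not> tops_le E S T"
proof -
  from assms(3) obtain U V where "construct E S" "construct E T" "set_less V U"
    "contracts U V S T \<or> contracts V U T S"
    by (auto simp: flip_cover_def constructs_def)
  then have "tops_le E T S \<and> \<not> tops_le E S T"
    using fusion_tops[OF _ _ assms(1,2)] split_tops[OF _ _ assms(1,2)] by metis
  then show "tops_le E T S" "\<not> tops_le E S T" by simp_all
qed

lemma flip_cover_rtrancl_tops:
  assumes "hypergraph E" "connected_hyp E" "(S, T) \<in> (flip_cover E)\<^sup>*"
  shows "tops_le E T S"
  using assms(3)
proof induction
  case base
  show ?case by (simp add: tops_le_def)
next
  case (step T T')
  then show ?case
    using flip_cover_tops(1)[OF assms(1,2)] tops_le_trans by metis
qed

theorem proposition2p12:
  fixes E :: "'a::linorder set set"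
  assumes "hypergraph E" and "connected_hyp E"
  shows "partial_order_on (constructs E) (flip_order E)"
proof -
  have "refl_on (constructs E) (flip_order E)"
    by (rule refl_onI) (simp add: flip_order_def)
  moreover have "trans (flip_order E)"
    by (rule transI) (auto simp: flip_order_def)
  moreover have "antisym (flip_order E)"
  proof (rule antisymI, rule ccontr)
    fix S T
    assume "(S, T) \<in> flip_order E" "(T, S) \<in> flip_order E" and "S \<noteq> T"
    then have path: "(S, T) \<in> (flip_cover E)\<^sup>*" "(T, S) \<in> (flip_cover E)\<^sup>*"
      by (simp_all add: flip_order_def)
    from path(1) show False
    proof (cases rule: converse_rtranclE)
      case base
      with \<open>S \<noteq> T\<close> show False by simp
    next
      case (step R)
      \<comment> \<open>A cycle through \<open>S\<close> returns from \<open>R\<close> to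
        \<open>S\<close> via \<open>T\<close>; monotonicity along this return contradicts the
        strictness of the first step from \<open>S\<close> to \<open>R\<close>.\<close>
      have "(R, S) \<in> (flip_cover E)\<^sup>*"
        using step(2) path(2) by (rule rtrancl_trans)
      then have "tops_le E S R"
        by (rule flip_cover_rtrancl_tops[OF assms])
      with flip_cover_tops(2)[OF assms step(1)] show False by simp
    qed
  qed
  moreover have "flip_order E \<subseteq> constructs E \<times> constructs E"
    by (simp add: flip_order_def)
  ultimately show ?thesis
    by (simp add: partial_order_on_def preorder_on_def)
qed

end
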